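(* Let $m=(m_1,m_2,m_3)$ be a triple of positive integers, $N=m_1+m_2+m_3$, and let $x_1,x_2>0$. Consider the inhomogeneous Ferrari-Martin multiline process on three species, a continuous-time Markov chain on the set $\Omega^{FM}_m$ of multiline queues of type $m$. The stationary weight of a configuration $\mathcal Q\in\Omega^{FM}_m$ is $$w(\mathcal Q)=x_1^{m_3-k}\,x_2^{k},$$ where $k$ is the number of covered 3's in $\mathcal Q$. Moreover, this process lumps, via the bully-path projection $B:\Omega^{FM}_m\to\Omega_m$, to the inhomogeneous multispecies exclusion process on $\Omega_m$.
   Context: Columns (sites) are indexed by $\mathbb Z/N\mathbb Z$, and "left"/"right" are cyclic. **Exclusion process.** $\Omega_m$ is the set of words $\pi=(\pi_1,\dots,\pi_N)\in\{1,2,3\}^N$ with exactly $m_j$ letters equal to $j$, for $j=1,2,3$. The inhomogeneous multispecies exclusion process on $\Omega_m$ is the continuous-time Markov chain in which, for each $i\in\mathbb Z/N\mathbb Z$, if $\pi_i=a$, $\pi_{i+1}=b$ and $a>b$, then the letters at sites $i,i+1$ are interchanged ($ab\to ba$) at rate $x_b$. **Multiline queues.** $\Omega^{FM}_m$ is the set of arrays $\mathcal Q=(\mathcal Q_{r,i})$ with $r\in\{1,2\}$ and $i\in\mathbb Z/N\mathbb Z$, with entries in $\{\circ,\bullet\}$ ($\circ$ = vacant, $\bullet$ = occupied), such that row 1 (the top row) has exactly $m_1$ $\bullet$'s and row 2 has exactly $m_1+m_2$ $\bullet$'s. **Bully-path projection $B:\Omega^{FM}_m\to\Omega_m$.** All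 $\bullet$'s in row 1 have class 1. Process the $\bullet$'s of row 1 one after another in any order: for a $\bullet$ at $(1,i)$, find the first column $i'$ in the cyclic sequence $i,i+1,i+2,\dots$ such that $(2,i')$ contains a $\bullet$ which has not yet been classified, and classify that $\bullet$ as class 1. The bully path of this particle goes from $(1,i)$ to $(2,i)$ and then through $(2,i+1),\dots,(2,i')$. After all of row 1 is processed, the remaining $m_2$ unclassified $\bullet$'s of row 2 get class 2, and the $\circ$'s of row 2 get class 3. $B(\mathcal Q)_i$ is the class at $(2,i)$. The result, and the set of $\circ$'s in row 2 traversed by bully paths, do not depend on the order. **Covered 3's.** If $B(\mathcal Q)_i=3$, this 3 is called covered if some bully path passes through the $\circ$ at $(2,i)$ (including the case where a bully path starts directly above at $(1,i)$), and non-covered otherwise. **Ringing path transitions.** For $\mathcal Q\in\Omega^{FM}_m$ and a site $i$, put $P_2=i$, and $P_1=i$ if $\mathcal Q_{2,i}=\bullet$, $P_1=i+1$ if $\mathcal Q_{2,i}=\circ$. The ringing path transition at $i$ does the following simultaneously for $r=1,2$: if $\mathcal Q_{r,P_r-1}=\circ$ and $\mathcal Q_{r,P_r}=\bullet$, these two entries are interchanged; otherwise row $r$ is unchanged. **Inhomogeneous Ferrari-Martin multiline process on three species.** The continuous-time Markov chain on $\Omega^{FM}_m$ in which, independently for each site $i$, the ringing path transition at $i$ is performed on the current state $\mathcal Q$ at rate $x_1$ if $B(\mathcal Q)_i=1$ or $B(\mathcal Q)_i$ is a covered 3, and at rate $x_2$ if $B(\mathcal Q)_i=2$ or $B(\mathcal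 Q)_i$ is a non-covered 3. (Transitions that do not change the state are ignored.) **Stationary weights.** $w$ is a stationary weight if for every state $\tau$: $\sum_{\tau'\ne\tau}\mathrm{rate}(\tau'\to\tau)\,w(\tau')=\sum_{\tau'\neq\tau}\mathrm{rate}(\tau\to\tau')\,w(\tau)$; stationary weights are unique up to a common scalar factor, so that the stationary distribution is $w$ normalized to total mass 1. **Lumping.** The chain on $\Omega^{FM}_m$ lumps via $B$ to the chain on $\Omega_m$ if for every $\mathcal Q\in\Omega^{FM}_m$ and every $\pi'\in\Omega_m$ with $\pi'\neq B(\mathcal Q)$, $\sum_{\mathcal Q':\,B(\mathcal Q')=\pi'}\mathrm{rate}(\mathcal Q\to\mathcal Q')=\mathrm{rate}(B(\mathcal Q)\to\pi')$. *)

theory Defs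
  imports Complex_Main "HOL-Library.Multiset"
begin

text \<open>
  The sites \<open>\<int>/N\<int>\<close> are represented by the naturals \<open>0, \<dots>, N - 1\<close>, with left and right
  neighbours taken modulo \<open>N\<close>. Words and rows of arrays are lists of length \<open>N\<close>.
\<close>

definition next_site :: "nat \<Rightarrow> nat \<Rightarrow> nat" where
  "next_site N i = (i + 1) mod N"

definition prev_site :: "nat \<Rightarrow> nat \<Rightarrow> nat" where
  "prev_site N i = (i + N - 1) mod N"

definition interchange :: "nat \<Rightarrow> nat \<Rightarrow> 'a list \<Rightarrow> 'a list" where
  "interchange i j xs = xs[i := xs ! j, j := xs ! i]"


section \<open>Continuous-time Markov chains on a finite state set\<close>

text \<open>
  A chain is given by its state set and its rates \<open>rate s t\<close> from \<open>s\<close> to \<open>t\<close>; the values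
  \<open>rate s s\<close> are irrelevant.
\<close>

definition stationary_weight :: "'s set \<Rightarrow> ('s \<Rightarrow> 's \<Rightarrow> real) \<Rightarrow> ('s \<Rightarrow> real) \<Rightarrow> bool" where
  "stationary_weight S rate w \<longleftrightarrow>
     (\<forall>t\<in>S. (\<Sum>s\<in>S - {t}. rate s t * w s) = (\<Sum>s\<in>S - {t}. rate t s * w t))"

definition lumps_via ::
  "'s set \<Rightarrow> ('s \<Rightarrow> 's \<Rightarrow> real) \<Rightarrow> ('s \<Rightarrow> 't) \<Rightarrow> 't set \<Rightarrow> ('t \<Rightarrow> 't \<Rightarrow> real) \<Rightarrow> bool" where
  "lumps_via S rate\<^sub>S f T rate\<^sub>T \<longleftrightarrow>
     f ` S \<subseteq> T \<and>
     (\<forall>s\<in>S. \<forall>t\<in>T. t \<noteq> f s \<longrightarrow> (\<Sum>s'\<in>{s'\<in>S. f s' = t}. rate\<^sub>S s s') = rate\<^sub>T (f s) t)"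


section \<open>The inhomogeneous multispecies exclusion process\<close>

definition words :: "nat \<Rightarrow> nat \<Rightarrow> nat \<Rightarrow> nat list set" where
  "words m\<^sub>1 m\<^sub>2 m\<^sub>3 = {\<pi>. length \<pi> = m\<^sub>1 + m\<^sub>2 + m\<^sub>3 \<and> set \<pi> \<subseteq> {1, 2, 3} \<and>
     count_list \<pi> 1 = m\<^sub>1 \<and> count_list \<pi> 2 = m\<^sub>2 \<and> count_list \<pi> 3 = m\<^sub>3}"

definition exclusion_rate :: "(nat \<Rightarrow> real) \<Rightarrow> nat list \<Rightarrow> nat list \<Rightarrow> real" where
  "exclusion_rate x \<pi> \<pi>' =
     (let N = length \<pi> in
      \<Sum>i<N. if \<pi> ! i > \<pi> ! next_site N i \<and> \<pi>' = interchange i (next_site N i) \<pi>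
            then x (\<pi> ! next_site N i) else 0)"


section \<open>Multiline queues and the bully-path projection\<close>

text \<open>A pair \<open>(top row, bottom row)\<close>; the entry \<open>True\<close> means occupied, \<open>False\<close> vacant.\<close>

type_synonym queue = "bool list \<times> bool list"

definition queues :: "nat \<Rightarrow> nat \<Rightarrow> nat \<Rightarrow> queue set" where
  "queues m\<^sub>1 m\<^sub>2 m\<^sub>3 = {(top, bot).
     length top = m\<^sub>1 + m\<^sub>2 + m\<^sub>3 \<and> length bot = m\<^sub>1 + m\<^sub>2 + m\<^sub>3 \<and>
     count_list top True = m\<^sub>1 \<and> count_list bot True = m\<^sub>1 + m\<^sub>2}"

definition width :: "queue \<Rightarrow> nat" where
  "width Q = length (snd Q)"

text \<open>
  The state of the bully-path procedure is a pair \<open>(U, V)\<close>: \<open>U\<close> is the set of columns of the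
  occupied, not yet classified entries of the bottom row, and \<open>V\<close> is the set of columns of all
  entries of the bottom row traversed so far. A step processes the particle in column \<open>i\<close> of
  the top row.
\<close>

definition bully_step :: "nat \<Rightarrow> nat \<Rightarrow> nat set \<times> nat set \<Rightarrow> nat set \<times> nat set" where
  "bully_step N i = (\<lambda>(U, V).
     let d = (LEAST d. (i + d) mod N \<in> U)
     in (U - {(i + d) mod N}, V \<union> (\<lambda>e. (i + e) mod N) ` {..d}))"

definition bully_run :: "queue \<Rightarrow> nat list \<Rightarrow> nat set \<times> nat set" where
  "bully_run Q order = fold (bully_step (width Q)) order ({j. j < width Q \<and> snd Q ! j}, {})"

text \<open>
  The particles of the top row are processed from left to right. By the lemma
  \<open>bully_run_any_order\<close> below, any other order gives the same result.
\<close>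

definition top_particles :: "queue \<Rightarrow> nat list" where
  "top_particles Q = filter (\<lambda>i. fst Q ! i) [0..<width Q]"

definition unclassified :: "queue \<Rightarrow> nat set" where
  "unclassified Q = fst (bully_run Q (top_particles Q))"

definition traversed :: "queue \<Rightarrow> nat set" where
  "traversed Q = snd (bully_run Q (top_particles Q))"

definition bully_projection :: "queue \<Rightarrow> nat list" where
  "bully_projection Q =
     map (\<lambda>i. if \<not> snd Q ! i then 3 else if i \<in> unclassified Q then 2 else 1) [0..<width Q]"

definition covered_threes :: "queue \<Rightarrow> nat set" where
  "covered_threes Q = {i. i < width Q \<and> bully_projection Q ! i = 3 \<and> i \<in> traversed Q}"


section \<open>The inhomogeneous Ferrari-Martin multiline process\<close>

definition jump_left :: "nat \<Rightarrow> bool list \<Rightarrow> bool list" where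
  "jump_left p row =
     (let q = prev_site (length row) p in
      if \<not> row ! q \<and> row ! p then interchange q p row else row)"

definition ring :: "nat \<Rightarrow> queue \<Rightarrow> queue" where
  "ring i Q =
     (let p\<^sub>2 = i; p\<^sub>1 = (if snd Q ! i then i else next_site (width Q) i)
      in (jump_left p\<^sub>1 (fst Q), jump_left p\<^sub>2 (snd Q)))"

definition ring_rate :: "(nat \<Rightarrow> real) \<Rightarrow> queue \<Rightarrow> nat \<Rightarrow> real" where
  "ring_rate x Q i =
     (if bully_projection Q ! i = 1 \<or> i \<in> covered_threes Q then x 1 else x 2)"

definition multiline_rate :: "(nat \<Rightarrow> real) \<Rightarrow> queue \<Rightarrow> queue \<Rightarrow> real" where
  "multiline_rate x Q Q' = (\<Sum>i<width Q. if ring i Q = Q' then ring_rate x Q i else 0)"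


section \<open>Independence of the processing order\<close>

lemma bully_dist:
  fixes N i :: nat
  assumes "U \<subseteq> {..<N}" "U \<noteq> {}"
  defines "d \<equiv> (LEAST d. (i + d) mod N \<in> U)"
  shows "(i + d) mod N \<in> U" and "\<And>e. e < d \<Longrightarrow> (i + e) mod N \<notin> U" and "d < N"
proof -
  obtain u where u: "u \<in> U" "u < N" using assms(1,2) by auto
  define e where "e = (u + (N - i mod N)) mod N"
  have N: "N > 0" using u by simp
  have "(i + e) mod N = (i mod N + (u + (N - i mod N))) mod N"
    unfolding e_def by (simp add: mod_simps)
  also have "i mod N + (u + (N - i mod N)) = u + N"
    using mod_less_divisor[OF N, of i] by linarith
  finally have ee: "(i + e) mod N \<in> U" using u by simp
  show "(i + d) mod N \<in> U" unfolding d_def using ee by (rule LeastI)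
  show "\<And>e. e < d \<Longrightarrow> (i + e) mod N \<notin> U" unfolding d_def using not_less_Least by blast
  have "d \<le> e" unfolding d_def using ee by (rule Least_le)
  also have "e < N" unfolding e_def using N by simp
  finally show "d < N" .
qed

lemma bully_stepI:
  assumes "(i + d) mod N = u" "u \<in> U" "\<And>e. e < d \<Longrightarrow> (i + e) mod N \<notin> U"
  shows "bully_step N i (U, V) = (U - {u}, V \<union> (\<lambda>e. (i + e) mod N) ` {..d})"
proof -
  have "(LEAST d. (i + d) mod N \<in> U) = d"
    by (rule Least_equality) (use assms not_le in auto)
  then show ?thesis using assms(1) by (simp add: bully_step_def)
qed

lemma bully_step_swap_aux:
  assumes U: "U \<subseteq> {..<N}" "card U \<ge> 2"
    and u: "(i + a) mod N = u" "(j + b) mod N = u" "u \<in> U" and ba: "b \<le> a"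
    and ji: "j mod N = (i + (a - b)) mod N"
    and ia: "\<And>e. e < a \<Longrightarrow> (i + e) mod N \<notin> U"
    and jb: "\<And>e. e < b \<Longrightarrow> (j + e) mod N \<notin> U"
  shows "bully_step N j (bully_step N i (U, V)) = bully_step N i (bully_step N j (U, V))"
proof -
  have fin: "finite U" using U(1) finite_subset by blast
  have U': "U - {u} \<subseteq> {..<N}" "U - {u} \<noteq> {}"
  proof -
    have "card (U - {u}) > 0" using U(2) u(3) fin by simp
    then show "U - {u} \<noteq> {}" by force
  qed (use U(1) in auto)
  define D where "D = (LEAST d. (u + d) mod N \<in> U - {u})"
  define v where "v = (u + D) mod N"
  have v: "v \<in> U - {u}" and D: "\<And>e. e < D \<Longrightarrow> (u + e) mod N \<notin> U - {u}"
    unfolding v_def D_def by (rule bully_dist(1,2)[OF U'] | assumption)+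
  have far: "(k + e) mod N \<notin> U - {u}"
    if "(k + c) mod N = u" "\<And>e. e < c \<Longrightarrow> (k + e) mod N \<notin> U" "e < c + D" for k c e
  proof (cases "e < c")
    case False
    define f where "f = e - c"
    have f: "e = c + f" "f < D" using False that(3) by (auto simp: f_def)
    have "(k + e) mod N = (u + f) mod N"
      unfolding f that(1)[symmetric] by (simp add: mod_simps add_ac)
    then show ?thesis using D[OF f(2)] by simp
  qed (use that in auto)
  have add: "(k + (c + e)) mod N = ((k + c) mod N + e) mod N" for k c e
    by (simp add: mod_simps add.assoc)
  have iv: "(i + (a + D)) mod N = v" and jv: "(j + (b + D)) mod N = v"
    unfolding v_def add u(1,2) by (rule refl)+
  have sh: "(j + e) mod N = (i + (a - b + e)) mod N" for e
    unfolding add ji[symmetric] by (simp add: mod_simps)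
  have "bully_step N i (U, V) = (U - {u}, V \<union> (\<lambda>e. (i + e) mod N) ` {..a})"
    using u(1,3) ia by (rule bully_stepI)
  moreover have "bully_step N j (U - {u}, W) =
      (U - {u} - {v}, W \<union> (\<lambda>e. (j + e) mod N) ` {..b + D})" for W
    using jv v far[OF u(2) jb] by (rule bully_stepI)
  ultimately have left: "bully_step N j (bully_step N i (U, V)) =
      (U - {u} - {v}, V \<union> (\<lambda>e. (i + e) mod N) ` {..a} \<union> (\<lambda>e. (j + e) mod N) ` {..b + D})"
    by simp
  have "bully_step N j (U, V) = (U - {u}, V \<union> (\<lambda>e. (j + e) mod N) ` {..b})"
    using u(2,3) jb by (rule bully_stepI)
  moreover have "bully_step N i (U - {u}, W) =
      (U - {u} - {v}, W \<union> (\<lambda>e. (i + e) mod N) ` {..a + D})" for W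
    using iv v far[OF u(1) ia] by (rule bully_stepI)
  ultimately have right: "bully_step N i (bully_step N j (U, V)) =
      (U - {u} - {v}, V \<union> (\<lambda>e. (j + e) mod N) ` {..b} \<union> (\<lambda>e. (i + e) mod N) ` {..a + D})"
    by simp
  have jimg: "(\<lambda>e. (j + e) mod N) ` {..c} = (\<lambda>e. (i + e) mod N) ` {a - b..a - b + c}" for c
  proof -
    have "(\<lambda>e. (j + e) mod N) ` {..c} = (\<lambda>e. (i + e) mod N) ` (\<lambda>e. a - b + e) ` {0..c}"
      by (simp add: image_image sh atLeast0AtMost)
    then show ?thesis by (simp add: image_add_atLeastAtMost add.commute)
  qed
  have "{..a} \<union> {a - b..a - b + (b + D)} = {..a + D}"
    "{a - b..a - b + b} \<union> {..a + D} = {..a + D}"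
    using ba by auto
  then show ?thesis
    unfolding left right jimg by (simp only: Un_assoc image_Un[symmetric])
qed

lemma bully_step_swap:
  assumes U: "U \<subseteq> {..<N}" "card U \<ge> 2"
  shows "bully_step N j (bully_step N i (U, V)) = bully_step N i (bully_step N j (U, V))"
proof -
  have ne: "U \<noteq> {}" using U(2) by auto
  define a b where "a = (LEAST d. (i + d) mod N \<in> U)" and "b = (LEAST d. (j + d) mod N \<in> U)"
  define u v where "u = (i + a) mod N" and "v = (j + b) mod N"
  have a: "(i + a) mod N = u" "u \<in> U" "\<And>e. e < a \<Longrightarrow> (i + e) mod N \<notin> U"
    unfolding a_def u_def by (rule refl bully_dist(1,2)[OF U(1) ne] | assumption)+
  have b: "(j + b) mod N = v" "v \<in> U" "\<And>e. e < b \<Longrightarrow> (j + e) mod N \<notin> U"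
    unfolding b_def v_def by (rule refl bully_dist(1,2)[OF U(1) ne] | assumption)+
  have shift: "l mod N = (k + (c - d)) mod N"
    if "d \<le> c" "(k + c) mod N = (l + d) mod N" for k l c d :: nat
  proof -
    have "int N dvd int (k + c) - int (l + d)"
      using that(2) by (metis mod_eq_dvd_iff of_nat_mod)
    also have "int (k + c) - int (l + d) = int (k + (c - d)) - int l" using that(1) by simp
    finally show ?thesis by (metis mod_eq_dvd_iff of_nat_eq_iff of_nat_mod)
  qed
  show ?thesis
  proof (cases "u = v")
    case False
    have i: "bully_step N i (A, W) = (A - {u}, W \<union> (\<lambda>e. (i + e) mod N) ` {..a})"
      if "u \<in> A" "A \<subseteq> U" for A W
      using a(1) that(1) by (rule bully_stepI) (use a(3) that(2) in blast)
    have j: "bully_step N j (A, W) = (A - {v}, W \<union> (\<lambda>e. (j + e) mod N) ` {..b})"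
      if "v \<in> A" "A \<subseteq> U" for A W
      using b(1) that(1) by (rule bully_stepI) (use b(3) that(2) in blast)
    show ?thesis using a(2) b(2) False by (auto simp: i j)
  next
    case True
    show ?thesis
    proof (cases "b \<le> a")
      case le: True
      show ?thesis
        using bully_step_swap_aux[OF U a(1) b(1)[folded True] a(2) le shift[OF le] a(3) b(3)]
          a(1) b(1) True by simp
    next
      case False
      then have le: "a \<le> b" by simp
      show ?thesis
        using bully_step_swap_aux[OF U b(1)[folded True] a(1) a(2) le shift[OF le] b(3) a(3)]
          a(1) b(1) True by simp
    qed
  qed
qed

lemma bully_step_fst:
  assumes "U \<subseteq> {..<N}" "U \<noteq> {}"
  obtains u W where "bully_step N i (U, V) = (U - {u}, W)" "u \<in> U"
  using bully_dist(1)[OF assms, of i] by (auto simp: bully_step_def Let_def)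

lemma fold_bully_step_front:
  assumes "U \<subseteq> {..<N}" "length is < card U"
  shows "fold (bully_step N) (is @ [i]) (U, V) = fold (bully_step N) (i # is) (U, V)"
  using assms
proof (induction "is" arbitrary: U V)
  case (Cons j js)
  have ne: "U \<noteq> {}" using Cons.prems by auto
  then obtain u W where u: "bully_step N j (U, V) = (U - {u}, W)" "u \<in> U"
    using bully_step_fst Cons.prems(1) by metis
  have "fold (bully_step N) (js @ [i]) (U - {u}, W) = fold (bully_step N) (i # js) (U - {u}, W)"
    using Cons.prems u(2) by (intro Cons.IH) auto
  moreover have "bully_step N i (bully_step N j (U, V)) = bully_step N j (bully_step N i (U, V))"
    using Cons.prems by (intro bully_step_swap) auto
  ultimately show ?case using u(1) by simp
qed simp

lemma fold_bully_step_mset: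
  assumes "U \<subseteq> {..<N}" "length is \<le> card U" "mset is = mset js"
  shows "fold (bully_step N) is (U, V) = fold (bully_step N) js (U, V)"
  using assms
proof (induction "is" arbitrary: js U V)
  case (Cons i "is")
  then have "i \<in> set js" by (metis list.set_intros(1) mset_eq_setD)
  then obtain ys zs where js: "js = ys @ i # zs" by (meson split_list)
  have len: "length ys + length zs = length is" and ms: "mset is = mset (ys @ zs)"
    using Cons.prems(3) mset_eq_length[OF Cons.prems(3)] js by auto
  have ne: "U \<noteq> {}" using Cons.prems by auto
  then obtain u W where u: "bully_step N i (U, V) = (U - {u}, W)" "u \<in> U"
    using bully_step_fst Cons.prems(1) by metis
  have "fold (bully_step N) js (U, V) = fold (bully_step N) zs (fold (bully_step N) (ys @ [i]) (U, V))"
    by (simp add: js)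
  also have "fold (bully_step N) (ys @ [i]) (U, V) = fold (bully_step N) (i # ys) (U, V)"
    using Cons.prems len by (intro fold_bully_step_front) auto
  also have "fold (bully_step N) zs \<dots> = fold (bully_step N) (ys @ zs) (U - {u}, W)"
    using u(1) by simp
  also have "\<dots> = fold (bully_step N) is (U - {u}, W)"
    using Cons.prems u(2) ms by (intro Cons.IH[symmetric]) auto
  finally show ?case using u(1) by simp
qed simp

lemma count_list_True: "count_list bs True = card {j. j < length bs \<and> bs ! j}"
  using length_filter_conv_card[of "(=) True" bs]
  by (simp add: count_list_eq_length_filter)

lemma bully_run_any_order:
  assumes Q: "Q \<in> queues m\<^sub>1 m\<^sub>2 m\<^sub>3"
    and order: "distinct order" "set order = {i. i < width Q \<and> fst Q ! i}"
  shows "bully_run Q order = bully_run Q (top_particles Q)"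
  unfolding bully_run_def
proof (rule fold_bully_step_mset)
  have len: "length (fst Q) = width Q" using Q by (auto simp: queues_def width_def)
  have "length order = card {i. i < width Q \<and> fst Q ! i}"
    using order distinct_card by metis
  also have "\<dots> = count_list (fst Q) True" by (simp add: count_list_True len)
  also have "\<dots> \<le> count_list (snd Q) True" using Q by (auto simp: queues_def)
  finally show "length order \<le> card {j. j < width Q \<and> snd Q ! j}"
    by (simp add: count_list_True width_def)
  show "mset order = mset (top_particles Q)"
    using order by (subst set_eq_iff_mset_eq_distinct[symmetric]) (auto simp: top_particles_def)
qed auto

end

theory Submission
  imports Defs
begin

text \<open>
  The bottom row is a cyclic queue in discrete time: a particle in the top row is an arrival, a
  particle in the bottom row is an offer of service. If \<open>q j\<close> is the number of customers who go on
  from site \<open>j\<close> to its right neighbour, then \<open>q j = q (j - 1) + a j - c j\<close>, cut off at \<open>0\<close>, where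
  \<open>a\<close> and \<open>c\<close> are the indicators of the two rows, and the set \<open>V\<close> of the sites traversed by bully
  paths consists of the sites that a customer visits: those with \<open>q (j - 1) + a j > 0\<close>. Everything
  in the theorem is a function of \<open>c\<close> and \<open>V\<close>: the class at \<open>j\<close> is 3 if \<open>j\<close> is vacant, otherwise 1
  or 2 according to whether \<open>j \<in> V\<close>; site \<open>i\<close> rings at rate \<open>x 1\<close> iff \<open>i \<in> V\<close>; and
  \<open>card V - m\<^sub>1\<close> is the number of covered 3's. Since more service is offered than there are
  arrivals, some \<open>q j\<close> is \<open>0\<close>, and this determines the solution \<open>q\<close> of the recursion
  (\<open>traversed_eq_busy\<close>). So the effect of a ring on \<open>V\<close> can be computed by exhibiting queue lengths
  for the new rows; they differ from the old ones at one site at most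
  (\<open>traversed_ring_vacant\<close>, \<open>traversed_ring_occupied\<close>).

  Lumping can then be read off: a ring at \<open>i\<close> sorts the classes at \<open>i - 1\<close> and \<open>i\<close>
  (\<open>projection_ring\<close>).

  For stationarity, follow the ringing path one step beyond the top row and let \<open>e\<close> be the site to
  the left of the one where it then arrives. The path can be traced backwards from \<open>e\<close>, so
  \<open>(Q, i) \<mapsto> (Q', e)\<close> is a permutation of the pairs of a state and a site (\<open>ring_inj\<close>). Moreover
  \<open>card (V' - {e}) = card (V - {i})\<close> (\<open>card_traversed_ring\<close>), which says that the weight of \<open>Q\<close>
  times the rate of \<open>i\<close> in \<open>Q\<close> equals the weight of \<open>Q'\<close> times the rate of \<open>e\<close> in \<open>Q'\<close>. Hence the
  flow into a state \<open>t\<close> is the sum over all sites \<open>e\<close> of the weight of \<open>t\<close> times the rate of \<open>e\<close>,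
  and this is the flow out of \<open>t\<close>.
\<close>

section \<open>Cyclic sites\<close>

lemma prev_site_eq: "i < N \<Longrightarrow> prev_site N i = (if i = 0 then N - 1 else i - 1)"
proof -
  assume i: "i < N"
  show ?thesis
  proof (cases "i = 0")
    case False
    then have "i + N - 1 = (i - 1) + N" by simp
    then have "prev_site N i = (i - 1) mod N" unfolding prev_site_def by (simp only: mod_add_self2)
    then show ?thesis using i False by simp
  qed (use i in \<open>simp add: prev_site_def\<close>)
qed

lemma next_site_eq: "i < N \<Longrightarrow> next_site N i = (if i + 1 = N then 0 else i + 1)"
  by (auto simp: next_site_def)

lemma site_less [simp]:
  assumes "i < N"
  shows "prev_site N i < N" "next_site N i < N"
  using assms by (auto simp: prev_site_eq next_site_eq)

lemma prev_next_site [simp]: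
  assumes "i < N"
  shows "prev_site N (next_site N i) = i" "next_site N (prev_site N i) = i"
  using assms by (auto simp: prev_site_eq next_site_eq)

lemma prev_site_neq:
  assumes "i < N" "N \<ge> 3"
  shows "prev_site N i \<noteq> i" "prev_site N (prev_site N i) \<noteq> i"
    "prev_site N (prev_site N i) \<noteq> prev_site N i"
  using assms by (auto simp: prev_site_eq split: if_splits)

lemma prev_site_inj: "i < N \<Longrightarrow> j < N \<Longrightarrow> prev_site N i = prev_site N j \<longleftrightarrow> i = j"
  by (metis prev_next_site(2))

lemma bij_betw_prev_site: "bij_betw (prev_site N) {..<N} {..<N}"
  by (rule bij_betw_byWitness[where f' = "next_site N"]) auto

lemma bij_betw_next_site: "bij_betw (next_site N) {..<N} {..<N}"
  by (rule bij_betw_byWitness[where f' = "prev_site N"]) auto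

lemma cyclic_induct:
  assumes "k < N" "P k" "\<And>j. j < N \<Longrightarrow> P (prev_site N j) \<Longrightarrow> P j" "j < N"
  shows "P j"
proof -
  have "P ((k + n) mod N)" for n
  proof (induction n)
    case (Suc n)
    have "next_site N ((k + n) mod N) = (k + Suc n) mod N"
      by (simp add: next_site_def mod_Suc_eq)
    moreover have "(k + n) mod N < N" using assms(1) by simp
    ultimately show ?case using Suc assms(3)[of "(k + Suc n) mod N"]
      by (metis site_less(2) prev_next_site(1))
  qed (use assms(1,2) in simp)
  from this[of "j + N - k"] show ?thesis using assms(1,4) by simp
qed

text \<open>The number of steps to the right that lead from site \<open>i\<close> to site \<open>j\<close>.\<close>

definition site_offset :: "nat \<Rightarrow> nat \<Rightarrow> nat \<Rightarrow> nat" where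
  "site_offset N i j = (if i \<le> j then j - i else j + N - i)"

lemma site_offset_iff:
  assumes "i < N" "j < N" "e < N"
  shows "(i + e) mod N = j \<longleftrightarrow> e = site_offset N i j"
proof (cases "i + e < N")
  case False
  then have "(i + e) mod N = i + e - N" using assms by (simp add: mod_if)
  then show ?thesis using assms False by (auto simp: site_offset_def)
qed (use assms in \<open>auto simp: site_offset_def\<close>)

lemma in_path_iff:
  assumes "i < N" "j < N" "S \<subseteq> {..<N}"
  shows "j \<in> (\<lambda>e. (i + e) mod N) ` S \<longleftrightarrow> site_offset N i j \<in> S"
  using site_offset_iff[OF assms(1,2)] assms(3) by (force simp: image_iff)

lemma site_offset_prev:
  assumes "i < N" "j < N"
  shows "site_offset N i (prev_site N j) = (if j = i then N - 1 else site_offset N i j - 1)"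
    and "site_offset N i j = 0 \<longleftrightarrow> j = i"
  using assms by (auto simp: site_offset_def prev_site_eq)


section \<open>Queue lengths\<close>

text \<open>The subtraction is truncated: service offered to an empty queue is lost.\<close>

definition queue_lengths :: "queue \<Rightarrow> (nat \<Rightarrow> nat) \<Rightarrow> bool" where
  "queue_lengths Q q \<longleftrightarrow> (\<forall>j<width Q.
     q j = q (prev_site (width Q) j) + of_bool (fst Q ! j) - of_bool (snd Q ! j))"

lemma queue_lengthsD:
  assumes "queue_lengths Q q" "j < width Q"
  shows "q j = q (prev_site (width Q) j) + of_bool (fst Q ! j) - of_bool (snd Q ! j)"
  using assms unfolding queue_lengths_def by blast

definition busy_sites :: "queue \<Rightarrow> (nat \<Rightarrow> nat) \<Rightarrow> nat set" where
  "busy_sites Q q = {j. j < width Q \<and> 0 < q (prev_site (width Q) j) + of_bool (fst Q ! j)}"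

text \<open>
  Queue lengths are built along with the bully paths: a path that ends \<open>d\<close> steps to the right of
  its start adds one waiting customer at each of its first \<open>d\<close> sites. The sets \<open>U\<close> and \<open>V\<close> stay
  disjoint because a path stops at the first member of \<open>U\<close> that it meets.
\<close>

lemma fold_bully_step_queue_lengths:
  assumes "distinct is" "set is \<subseteq> {..<N}" "C \<subseteq> {..<N}" "length is \<le> card C"
    and "fold (bully_step N) is (C, {}) = (U, V)"
  shows "U \<subseteq> C \<and> card U + length is = card C \<and> U \<inter> V = {} \<and>
    (\<exists>q :: nat \<Rightarrow> nat. (\<forall>j<N. q j + of_bool (j \<in> C - U) = q (prev_site N j) + of_bool (j \<in> set is)) \<and>
      V = {j. j < N \<and> 0 < q (prev_site N j) + of_bool (j \<in> set is)})"
  using assms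
proof (induction "is" arbitrary: U V rule: rev_induct)
  case Nil
  then show ?case by (intro conjI exI[of _ "\<lambda>_. 0"]) auto
next
  case (snoc i js)
  obtain U0 V0 where f: "fold (bully_step N) js (C, {}) = (U0, V0)" by fastforce
  have i: "i < N" "i \<notin> set js" using snoc.prems by auto
  obtain q :: "nat \<Rightarrow> nat" where U0: "U0 \<subseteq> C" "card U0 + length js = card C" "U0 \<inter> V0 = {}"
    and q: "\<And>j. j < N \<Longrightarrow> q j + of_bool (j \<in> C - U0) = q (prev_site N j) + of_bool (j \<in> set js)"
    and V0: "V0 = {j. j < N \<and> 0 < q (prev_site N j) + of_bool (j \<in> set js)}"
  proof -
    have "distinct js" "set js \<subseteq> {..<N}" "length js \<le> card C" using snoc.prems by auto
    from snoc.IH[OF this(1,2) snoc.prems(3) this(3) f] show ?thesis using that by blast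
  qed
  have UN: "U0 \<subseteq> {..<N}" "U0 \<noteq> {}" using U0 snoc.prems by auto
  define d where "d = (LEAST d. (i + d) mod N \<in> U0)"
  define u where "u = (i + d) mod N"
  note d = bully_dist[OF UN, where i = i, folded d_def]
  define path where "path = (\<lambda>e. (i + e) mod N) ` {..d}"
  have UV: "U = U0 - {u}" "V = V0 \<union> path"
  proof -
    have "bully_step N i (U0, V0) = (U, V)" using snoc.prems(5) f by simp
    then show "U = U0 - {u}" "V = V0 \<union> path"
      by (simp_all add: bully_step_def Let_def d_def u_def path_def)
  qed
  have uN: "u \<in> U0" "u < N" using d(1) UN by (auto simp: u_def)
  have off_u: "site_offset N i u = d"
    using site_offset_iff[OF i(1) uN(2) d(3)] by (simp add: u_def)
  have path: "j \<in> path \<longleftrightarrow> site_offset N i j \<le> d" if "j < N" for j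
    unfolding path_def using in_path_iff[OF i(1) that, of "{..d}"] d(3)
    by (simp add: subset_eq)
  have off_eq: "site_offset N i j = d \<longleftrightarrow> j = u" if "j < N" for j
    using site_offset_iff[OF i(1) that d(3)] by (auto simp: u_def)
  define q' where "q' j = q j + of_bool (site_offset N i j < d)" for j
  have prev: "of_bool (site_offset N i (prev_site N j) < d) + of_bool (j = i)
      = (of_bool (j \<in> path) :: nat)" if "j < N" for j
    using site_offset_prev[OF i(1) that] path[OF that] d(3) by auto
  have last: "of_bool (site_offset N i j < d) + of_bool (j = u) = (of_bool (j \<in> path) :: nat)"
    if "j < N" for j
    using path[OF that] off_eq[OF that] by auto
  have free: "j \<notin> U0" if "site_offset N i j < d" "j < N" for j
    using d(2)[OF that(1)] site_offset_iff[OF i(1) that(2), of "site_offset N i j"] that d(3) by auto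
  have set: "of_bool (j \<in> set (js @ [i])) = (of_bool (j \<in> set js) + of_bool (j = i) :: nat)" for j
    using i(2) by auto
  have in': "q' (prev_site N j) + of_bool (j \<in> set (js @ [i]))
      = q (prev_site N j) + of_bool (j \<in> set js) + of_bool (j \<in> path)" if "j < N" for j
    using prev[OF that] unfolding set q'_def by linarith
  have "q' j + of_bool (j \<in> C - U) = q' (prev_site N j) + of_bool (j \<in> set (js @ [i]))"
    if "j < N" for j
  proof -
    have "of_bool (j \<in> C - U) = (of_bool (j \<in> C - U0) + of_bool (j = u) :: nat)"
      using uN U0(1) UV by auto
    then show ?thesis using in'[OF that] last[OF that] q[OF that] unfolding q'_def by linarith
  qed
  moreover have "V = {j. j < N \<and> 0 < q' (prev_site N j) + of_bool (j \<in> set (js @ [i]))}"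
  proof -
    have "path \<subseteq> {..<N}" using i by (auto simp: path_def)
    have iff: "0 < q' (prev_site N j) + of_bool (j \<in> set (js @ [i])) \<longleftrightarrow>
        0 < q (prev_site N j) + of_bool (j \<in> set js) \<or> j \<in> path" if "j < N" for j
    proof -
      have "0 < m \<longleftrightarrow> 0 < n \<or> P" if "m = n + of_bool P" for m n :: nat and P
        using that by auto
      from this[OF in'[OF that]] show ?thesis .
    qed
    have "j \<in> V \<longleftrightarrow> j < N \<and> 0 < q' (prev_site N j) + of_bool (j \<in> set (js @ [i]))" for j
    proof (cases "j < N")
      case True
      show ?thesis
        unfolding iff[OF True] UV(2) V0 Un_iff mem_Collect_eq by (simp only: True simp_thms)
    next
      case False
      then show ?thesis using UV(2) V0 \<open>path \<subseteq> {..<N}\<close> by blast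
    qed
    then show ?thesis by (intro set_eqI) (simp only: mem_Collect_eq)
  qed
  moreover have "U \<inter> V = {}"
  proof -
    have "j \<notin> path" if "j \<in> U" for j
    proof -
      have j: "j < N" "j \<in> U0" "j \<noteq> u" using that UV UN by auto
      then show ?thesis using path[of j] off_eq[of j] free[of j] by force
    qed
    then show ?thesis using U0(3) UV by auto
  qed
  moreover have "card U + length (js @ [i]) = card C"
  proof -
    have "finite U0" using UN finite_subset by blast
    then have "Suc (card U) = card U0" unfolding UV(1) using uN(1) by (rule card_Suc_Diff1)
    then show ?thesis using U0(2) by simp
  qed
  moreover have "U \<subseteq> C" using U0(1) UV(1) by blast
  ultimately show ?case by (intro conjI exI[of _ q'] allI impI)
qed

lemma queue_width:
  assumes "Q \<in> queues m\<^sub>1 m\<^sub>2 m\<^sub>3"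
  shows "length (fst Q) = m\<^sub>1 + m\<^sub>2 + m\<^sub>3" "length (snd Q) = m\<^sub>1 + m\<^sub>2 + m\<^sub>3"
    "width Q = m\<^sub>1 + m\<^sub>2 + m\<^sub>3"
  using assms by (auto simp: queues_def width_def)

lemma queue_card:
  assumes "Q \<in> queues m\<^sub>1 m\<^sub>2 m\<^sub>3"
  shows "card {j. j < width Q \<and> fst Q ! j} = m\<^sub>1" "card {j. j < width Q \<and> snd Q ! j} = m\<^sub>1 + m\<^sub>2"
  using assms by (auto simp: queues_def width_def count_list_True)

lemma queue_lengths_exist:
  assumes Q: "Q \<in> queues m\<^sub>1 m\<^sub>2 m\<^sub>3"
  obtains q where "queue_lengths Q q" "traversed Q = busy_sites Q q"
    "unclassified Q = {j. j < width Q \<and> snd Q ! j} - busy_sites Q q"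
    "card (unclassified Q) = m\<^sub>2"
proof -
  define N C ps where "N = width Q" and "C = {j. j < N \<and> snd Q ! j}" and "ps = top_particles Q"
  have ps: "distinct ps" "set ps = {j. j < N \<and> fst Q ! j}"
    by (auto simp: ps_def top_particles_def N_def)
  have len: "length ps = m\<^sub>1" using ps distinct_card[OF ps(1)] queue_card[OF Q] by (simp add: N_def)
  have cC: "card C = m\<^sub>1 + m\<^sub>2" using queue_card[OF Q] by (simp add: N_def C_def)
  have run: "fold (bully_step N) ps (C, {}) = (unclassified Q, traversed Q)"
    by (simp add: unclassified_def traversed_def bully_run_def N_def C_def ps_def)
  obtain q :: "nat \<Rightarrow> nat" where U: "unclassified Q \<subseteq> C" "card (unclassified Q) + length ps = card C"
      "unclassified Q \<inter> traversed Q = {}"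
    and q: "\<And>j. j < N \<Longrightarrow>
      q j + of_bool (j \<in> C - unclassified Q) = q (prev_site N j) + of_bool (j \<in> set ps)"
    and V: "traversed Q = {j. j < N \<and> 0 < q (prev_site N j) + of_bool (j \<in> set ps)}"
  proof -
    have "set ps \<subseteq> {..<N}" "C \<subseteq> {..<N}" "length ps \<le> card C" using ps len cC by (auto simp: C_def)
    from fold_bully_step_queue_lengths[OF ps(1) this run] show ?thesis using that by blast
  qed
  have V': "traversed Q = busy_sites Q q"
    unfolding V busy_sites_def using ps by (auto simp: N_def)
  have UC: "unclassified Q = C - traversed Q"
  proof -
    have "j \<in> traversed Q" if "j \<in> C" "j \<notin> unclassified Q" for j
      using q[of j] that unfolding V by (auto simp: C_def)
    then show ?thesis using U by auto
  qed
  have "queue_lengths Q q"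
    unfolding queue_lengths_def
  proof (intro allI impI)
    fix j assume "j < width Q"
    then have j: "j < N" by (simp add: N_def)
    have "j \<in> set ps \<longleftrightarrow> fst Q ! j" "j \<in> C - unclassified Q \<longleftrightarrow> snd Q ! j \<and> j \<in> traversed Q"
      using ps(2) UC j by (auto simp: C_def)
    moreover have "j \<in> traversed Q \<longleftrightarrow> 0 < q (prev_site N j) + of_bool (j \<in> set ps)"
      unfolding V mem_Collect_eq by (simp only: j simp_thms)
    ultimately show "q j = q (prev_site (width Q) j) + of_bool (fst Q ! j) - of_bool (snd Q ! j)"
      using q[OF j] unfolding N_def[symmetric] by (auto split: if_splits)
  qed
  then show ?thesis using that V' UC U(2) cC len by (simp add: C_def N_def)
qed

text \<open>
  If no queue length vanished, no service would be lost, and summing the recursion around the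
  cycle would give as many particles in the bottom row as in the top row.
\<close>

lemma queue_lengths_zero:
  assumes Q: "Q \<in> queues m\<^sub>1 m\<^sub>2 m\<^sub>3" "m\<^sub>2 > 0" and q: "queue_lengths Q q"
  shows "\<exists>k<width Q. q k = 0"
proof (rule ccontr)
  assume no_zero: "\<not> ?thesis"
  define N where "N = width Q"
  have pos: "q j > 0" if "j < N" for j using no_zero that by (auto simp: N_def)
  have "q j + of_bool (snd Q ! j) = q (prev_site N j) + of_bool (fst Q ! j)" if "j < N" for j
  proof -
    have "q j = q (prev_site N j) + of_bool (fst Q ! j) - of_bool (snd Q ! j)"
      using queue_lengthsD[OF q] that by (simp only: N_def)
    then show ?thesis using pos[OF that] by linarith
  qed
  then have "(\<Sum>j<N. q j + of_bool (snd Q ! j)) = (\<Sum>j<N. q (prev_site N j) + of_bool (fst Q ! j))"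
    by (intro sum.cong) auto
  moreover have "(\<Sum>j<N. q (prev_site N j)) = (\<Sum>j<N. q j)"
    by (rule sum.reindex_bij_betw[OF bij_betw_prev_site])
  ultimately have "(\<Sum>j<N. of_bool (snd Q ! j)) = (\<Sum>j<N. of_bool (fst Q ! j) :: nat)"
    by (simp add: sum.distrib)
  moreover have "{..<N} \<inter> {j. P j} = {j. j < N \<and> P j}" for P by auto
  ultimately show False using queue_card[OF Q(1)] Q(2) by (simp add: N_def)
qed

text \<open>
  The recursion is monotone, so an inequality between two solutions passes from each site to the
  next; it certainly holds where \<open>q\<close> vanishes.
\<close>

lemma queue_lengths_le:
  assumes Q: "Q \<in> queues m\<^sub>1 m\<^sub>2 m\<^sub>3" "m\<^sub>2 > 0"
    and q: "queue_lengths Q q" "queue_lengths Q q'" and j: "j < width Q"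
  shows "q j \<le> q' j"
proof -
  obtain k where k: "k < width Q" "q k = 0" using queue_lengths_zero[OF Q q(1)] by blast
  show ?thesis
  proof (rule cyclic_induct[where P = "\<lambda>j. q j \<le> q' j", OF k(1) _ _ j])
    fix j assume j: "j < width Q" and le: "q (prev_site (width Q) j) \<le> q' (prev_site (width Q) j)"
    from queue_lengthsD[OF q(1) j] queue_lengthsD[OF q(2) j] le show "q j \<le> q' j" by linarith
  qed (use k in simp)
qed

lemma traversed_eq_busy:
  assumes Q: "Q \<in> queues m\<^sub>1 m\<^sub>2 m\<^sub>3" "m\<^sub>2 > 0" and q: "queue_lengths Q q"
  shows "traversed Q = busy_sites Q q"
proof -
  obtain q' where q': "queue_lengths Q q'" "traversed Q = busy_sites Q q'"
    using queue_lengths_exist[OF Q(1)] .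
  have eq: "q j = q' j" if "j < width Q" for j
    using queue_lengths_le[OF Q q q'(1) that] queue_lengths_le[OF Q q'(1) q that] by simp
  have "busy_sites Q q = busy_sites Q q'"
    unfolding busy_sites_def by (intro Collect_cong conj_cong refl) (simp only: eq site_less)
  then show ?thesis using q'(2) by simp
qed

lemma
  assumes Q: "Q \<in> queues m\<^sub>1 m\<^sub>2 m\<^sub>3"
  shows traversed_less: "traversed Q \<subseteq> {..<width Q}"
    and card_unclassified: "card (unclassified Q) = m\<^sub>2"
    and unclassified_eq: "unclassified Q = {j. j < width Q \<and> snd Q ! j} - traversed Q"
proof -
  obtain q where "traversed Q = busy_sites Q q"
    "unclassified Q = {j. j < width Q \<and> snd Q ! j} - busy_sites Q q" "card (unclassified Q) = m\<^sub>2"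
    using queue_lengths_exist[OF Q] .
  then show "traversed Q \<subseteq> {..<width Q}" "card (unclassified Q) = m\<^sub>2"
    "unclassified Q = {j. j < width Q \<and> snd Q ! j} - traversed Q"
    by (simp_all add: busy_sites_def subset_eq)
qed

lemma projection_nth:
  assumes Q: "Q \<in> queues m\<^sub>1 m\<^sub>2 m\<^sub>3" and j: "j < width Q"
  shows "bully_projection Q ! j = (if \<not> snd Q ! j then 3 else if j \<in> traversed Q then 1 else 2)"
  using j by (auto simp: bully_projection_def unclassified_eq[OF Q])

lemma length_projection [simp]: "length (bully_projection Q) = width Q"
  by (simp add: bully_projection_def)

lemma ring_rate_eq:
  assumes Q: "Q \<in> queues m\<^sub>1 m\<^sub>2 m\<^sub>3" and i: "i < width Q"
  shows "ring_rate x Q i = (if i \<in> traversed Q then x 1 else x 2)"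
  using i by (auto simp: ring_rate_def covered_threes_def projection_nth[OF Q])

text \<open>
  The class-2 sites form the set \<open>unclassified Q\<close> of \<open>m\<^sub>2\<close> elements; counting particles
  and vacancies of the bottom row gives the rest.
\<close>

lemma card_traversed:
  assumes Q: "Q \<in> queues m\<^sub>1 m\<^sub>2 m\<^sub>3"
  shows "card (traversed Q) = m\<^sub>1 + card (covered_threes Q)" "card (covered_threes Q) \<le> m\<^sub>3"
    "card {j. j < width Q \<and> bully_projection Q ! j = 1} = m\<^sub>1"
    "card {j. j < width Q \<and> bully_projection Q ! j = 2} = m\<^sub>2"
    "card {j. j < width Q \<and> bully_projection Q ! j = 3} = m\<^sub>3"
proof -
  define C where "C = {j. j < width Q \<and> snd Q ! j}"
  have fin: "finite C" "finite (traversed Q)" and sub: "C \<subseteq> {..<width Q}"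
    using traversed_less[OF Q] finite_subset by (auto simp: C_def)
  have 3: "{j. j < width Q \<and> bully_projection Q ! j = 3} = {..<width Q} - C"
    and 2: "{j. j < width Q \<and> bully_projection Q ! j = 2} = unclassified Q"
    and 1: "{j. j < width Q \<and> bully_projection Q ! j = 1} = C - unclassified Q"
    and cov: "covered_threes Q = traversed Q - (C - unclassified Q)"
    using traversed_less[OF Q]
    by (auto simp: projection_nth[OF Q] unclassified_eq[OF Q] C_def covered_threes_def split: if_splits)
  have U: "unclassified Q \<subseteq> C" "C - unclassified Q \<subseteq> traversed Q"
    by (auto simp: unclassified_eq[OF Q] C_def)
  have cC: "card C = m\<^sub>1 + m\<^sub>2" using queue_card[OF Q] by (simp add: C_def)
  have c1: "card (C - unclassified Q) = m\<^sub>1"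
    using U(1) fin cC card_unclassified[OF Q] by (simp add: card_Diff_subset finite_subset)
  have c3: "card ({..<width Q} - C) = m\<^sub>3"
    using sub fin cC queue_width[OF Q] by (simp add: card_Diff_subset)
  show "card {j. j < width Q \<and> bully_projection Q ! j = 1} = m\<^sub>1"
    "card {j. j < width Q \<and> bully_projection Q ! j = 2} = m\<^sub>2"
    "card {j. j < width Q \<and> bully_projection Q ! j = 3} = m\<^sub>3"
    unfolding 1 2 3 using c1 c3 card_unclassified[OF Q] by auto
  show "card (traversed Q) = m\<^sub>1 + card (covered_threes Q)"
    unfolding cov using U(2) fin c1 card_mono[OF fin(2) U(2)]
    by (simp add: card_Diff_subset finite_subset)
  have "covered_threes Q \<subseteq> {..<width Q} - C"
    by (auto simp: covered_threes_def projection_nth[OF Q] C_def split: if_splits)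
  then show "card (covered_threes Q) \<le> m\<^sub>3" using c3 card_mono[of "{..<width Q} - C"] by simp
qed

lemma count_list_nth: "count_list xs c = card {j. j < length xs \<and> xs ! j = c}"
  using length_filter_conv_card[of "(=) c" xs]
  by (simp add: count_list_eq_length_filter eq_commute)

lemma projection_in_words:
  assumes Q: "Q \<in> queues m\<^sub>1 m\<^sub>2 m\<^sub>3"
  shows "bully_projection Q \<in> words m\<^sub>1 m\<^sub>2 m\<^sub>3"
proof -
  have "set (bully_projection Q) \<subseteq> {1, 2, 3}" by (auto simp: bully_projection_def)
  then show ?thesis
    using card_traversed[OF Q] queue_width[OF Q] by (simp add: words_def count_list_nth)
qed


section \<open>One jump in a row\<close>

lemma length_interchange [simp]: "length (interchange i j xs) = length xs"
  by (simp add: interchange_def)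

lemma interchange_nth:
  "i < length xs \<Longrightarrow> j < length xs \<Longrightarrow> k < length xs \<Longrightarrow>
    interchange i j xs ! k = (if k = j then xs ! i else if k = i then xs ! j else xs ! k)"
  by (auto simp: interchange_def nth_list_update)

lemma length_jump_left [simp]: "length (jump_left p row) = length row"
  by (simp add: jump_left_def Let_def)

lemma jump_left_nth:
  assumes "p < length row" "j < length row"
  shows "jump_left p row ! j =
    (let h = prev_site (length row) p in
     if j = h then row ! h \<or> row ! p else if j = p then row ! h \<and> row ! p else row ! j)"
  using assms by (auto simp: jump_left_def Let_def interchange_nth)

lemma count_list_jump_left:
  assumes "p < length row"
  shows "count_list (jump_left p row) b = count_list row b"
proof -
  have "mset (jump_left p row) = mset row"
    using assms mset_swap[of p row "prev_site (length row) p"]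
    by (auto simp: jump_left_def Let_def interchange_def)
  then show ?thesis by (metis count_mset)
qed

text \<open>
  The ringing path that rings site \<open>p\<close> of a row goes on in the row above at \<open>p\<close> or at the next site.
  The left neighbour of that site is recorded here, because its entry after the ring remembers
  which of the two cases occurred.
\<close>

definition exit_site :: "nat \<Rightarrow> bool list \<Rightarrow> nat" where
  "exit_site p row = (if row ! p then prev_site (length row) p else p)"

lemma exit_site_less: "p < length row \<Longrightarrow> exit_site p row < length row"
  by (simp add: exit_site_def)

text \<open>
  The exit site tells the old row from the new one: it is occupied after the ring iff \<open>p\<close> was
  occupied before. This recovers \<open>p\<close>, and then the two entries that may have changed.
\<close>

lemma jump_left_inj:
  assumes "length row = N" "length row' = N" "p < N" "p' < N" "N \<ge> 3"
    and eq: "jump_left p row = jump_left p' row'" "exit_site p row = exit_site p' row'"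
  shows "row = row' \<and> p = p'"
proof -
  have occ: "jump_left p row ! exit_site p row = row ! p" if "length row = N" "p < N" for p row
    using that prev_site_neq[of p N] \<open>N \<ge> 3\<close>
    by (simp add: jump_left_nth exit_site_def Let_def)
  have "row ! p = row' ! p'" using occ[of row p] occ[of row' p'] assms by simp
  then have p: "p = p'"
    using eq(2) prev_site_inj assms by (auto simp: exit_site_def split: if_splits)
  have "row ! j = row' ! j" if "j < N" for j
  proof -
    define h where "h = prev_site N p"
    have h: "h < N" "h \<noteq> p" using assms prev_site_neq[of p N] by (auto simp: h_def)
    have val: "jump_left p row ! k = jump_left p row' ! k" for k using eq(1) p by simp
    show ?thesis
      using val[of j] val[of h] val[of p] \<open>row ! p = row' ! p'\<close> h that assms p
      by (auto simp: jump_left_nth Let_def simp flip: h_def split: if_splits)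
  qed
  then show ?thesis using p assms by (auto intro: nth_equalityI)
qed


section \<open>The ringing path\<close>

text \<open>The site \<open>P\<^sub>1\<close> of the ringing path that starts at \<open>P\<^sub>2 = i\<close>.\<close>

definition top_site :: "nat \<Rightarrow> queue \<Rightarrow> nat" where
  "top_site i Q = (if snd Q ! i then i else next_site (width Q) i)"

lemma ring_eq: "ring i Q = (jump_left (top_site i Q) (fst Q), jump_left i (snd Q))"
  by (simp add: ring_def top_site_def)

lemma top_site_less: "i < width Q \<Longrightarrow> top_site i Q < width Q"
  by (simp add: top_site_def)

lemma width_ring [simp]: "width (ring i Q) = width Q"
  by (simp add: ring_eq width_def)

lemma ring_in_queues:
  assumes Q: "Q \<in> queues m\<^sub>1 m\<^sub>2 m\<^sub>3" and i: "i < width Q"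
  shows "ring i Q \<in> queues m\<^sub>1 m\<^sub>2 m\<^sub>3"
proof -
  obtain a c where ac: "Q = (a, c)" by fastforce
  show ?thesis
    using Q i top_site_less[OF i] unfolding ring_eq ac
    by (auto simp: queues_def width_def count_list_jump_left)
qed

definition ring_exit :: "nat \<Rightarrow> queue \<Rightarrow> nat" where
  "ring_exit i Q = exit_site (top_site i Q) (fst Q)"

lemma ring_exit_less:
  assumes "Q \<in> queues m\<^sub>1 m\<^sub>2 m\<^sub>3" "i < width Q"
  shows "ring_exit i Q < width Q"
  using exit_site_less[of "top_site i Q" "fst Q"] top_site_less[OF assms(2)] queue_width[OF assms(1)]
  by (simp add: ring_exit_def)

text \<open>
  The path is traced backwards through the two rows. The link between them is that \<open>top_site\<close> is
  the right neighbour of the exit site of the bottom row.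
\<close>

lemma ring_inj:
  assumes Q: "Q \<in> queues m\<^sub>1 m\<^sub>2 m\<^sub>3" "Q' \<in> queues m\<^sub>1 m\<^sub>2 m\<^sub>3"
    and i: "i < m\<^sub>1 + m\<^sub>2 + m\<^sub>3" "i' < m\<^sub>1 + m\<^sub>2 + m\<^sub>3" and N: "m\<^sub>1 + m\<^sub>2 + m\<^sub>3 \<ge> 3"
    and eq: "ring i Q = ring i' Q'" "ring_exit i Q = ring_exit i' Q'"
  shows "Q = Q' \<and> i = i'"
proof -
  define N where "N = m\<^sub>1 + m\<^sub>2 + m\<^sub>3"
  have w: "length (fst Q) = N" "length (snd Q) = N" "width Q = N"
    "length (fst Q') = N" "length (snd Q') = N" "width Q' = N" "N \<ge> 3" "i < N" "i' < N"
    using queue_width[OF Q(1)] queue_width[OF Q(2)] N i by (auto simp: N_def)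
  have t: "top_site i Q < N" "top_site i' Q' < N" using w by (auto simp: top_site_def)
  have top: "fst Q = fst Q' \<and> top_site i Q = top_site i' Q'"
    by (rule jump_left_inj[OF w(1,4) t \<open>N \<ge> 3\<close>]) (use eq in \<open>auto simp: ring_eq ring_exit_def\<close>)
  have top': "top_site j P = next_site N (exit_site j (snd P))"
    if "length (snd P) = N" "width P = N" "j < N" for j P
    using that by (simp add: top_site_def exit_site_def)
  have "exit_site i (snd Q) = exit_site i' (snd Q')"
    using top top' w exit_site_less by (metis prev_next_site(1))
  then have "snd Q = snd Q' \<and> i = i'"
    by (intro jump_left_inj[OF w(2,5,8,9,7)]) (use eq in \<open>auto simp: ring_eq\<close>)
  then show ?thesis using top by (simp add: prod_eq_iff)
qed

lemma traversed_prev: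
  assumes Q: "Q \<in> queues m\<^sub>1 m\<^sub>2 m\<^sub>3" "m\<^sub>2 > 0" and j: "j < width Q"
  defines "h \<equiv> prev_site (width Q) j"
  shows "fst Q ! j \<Longrightarrow> j \<in> traversed Q"
    and "j \<in> traversed Q \<Longrightarrow> fst Q ! j \<or> h \<in> traversed Q"
    and "\<not> snd Q ! h \<Longrightarrow> h \<in> traversed Q \<Longrightarrow> j \<in> traversed Q"
proof -
  obtain q where q: "queue_lengths Q q" using queue_lengths_exist[OF Q(1)] .
  have "h < width Q" using j by (simp add: h_def)
  define m where "m = q (prev_site (width Q) h)"
  have qh: "q h = m + of_bool (fst Q ! h) - of_bool (snd Q ! h)"
    using queue_lengthsD[OF q \<open>h < width Q\<close>] by (simp only: m_def)
  have V: "k \<in> traversed Q \<longleftrightarrow> 0 < q (prev_site (width Q) k) + of_bool (fst Q ! k)"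
    if "k < width Q" for k
    using that by (simp add: traversed_eq_busy[OF Q q] busy_sites_def)
  show "fst Q ! j \<Longrightarrow> j \<in> traversed Q" "j \<in> traversed Q \<Longrightarrow> fst Q ! j \<or> h \<in> traversed Q"
    "\<not> snd Q ! h \<Longrightarrow> h \<in> traversed Q \<Longrightarrow> j \<in> traversed Q"
    using V[OF j, folded h_def] V[OF \<open>h < width Q\<close>, folded m_def] qh
    by auto
qed

text \<open>
  When the ringing site \<open>i\<close> is vacant in the bottom row, the arrival at the next site \<open>g\<close>, if it
  moves, comes one site earlier and is not served at \<open>i\<close>. So it waits there, and the queue
  from \<open>g\<close> on is unchanged. If both \<open>i\<close> and \<open>g\<close> have an arrival then nothing moves, but \<open>i\<close> is
  traversed already.
\<close>

lemma traversed_ring_vacant: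
  assumes Q: "Q \<in> queues m\<^sub>1 m\<^sub>2 m\<^sub>3" "m\<^sub>2 > 0" and N: "m\<^sub>1 + m\<^sub>2 + m\<^sub>3 \<ge> 3"
    and i: "i < width Q" "\<not> snd Q ! i"
  defines "g \<equiv> next_site (width Q) i"
  shows "traversed (ring i Q) = (if fst Q ! g then insert i (traversed Q) else traversed Q)"
proof -
  define N a c where "N = width Q" and "a = fst Q" and "c = snd Q"
  define a' c' where "a' = fst (ring i Q)" and "c' = snd (ring i Q)"
  have len: "length a = N" "length c = N" "N \<ge> 3" "i < N" "g < N"
    using queue_width[OF Q(1)] N i by (auto simp: N_def a_def c_def g_def)
  have ig: "prev_site N g = i" "g \<noteq> i" "prev_site N i \<noteq> i" "prev_site N i \<noteq> g"
    using len prev_site_neq[of g N] prev_site_neq[of i N] by (auto simp: g_def N_def)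
  have a': "a' ! j = (if j = i then a ! i \<or> a ! g else if j = g then a ! i \<and> a ! g else a ! j)"
    if "j < N" for j
    using that len ig i(2)
    by (simp add: a'_def ring_eq top_site_def jump_left_nth Let_def flip: g_def a_def)
  have c': "c' ! j = c ! j" if "j < N" for j
    using that len i(2) by (auto simp: c'_def c_def ring_eq jump_left_nth Let_def)
  obtain q where q: "queue_lengths Q q" using queue_lengths_exist[OF Q(1)] .
  have rec: "q j = q (prev_site N j) + of_bool (a ! j) - of_bool (c ! j)" if "j < N" for j
    using queue_lengthsD[OF q] that by (simp only: N_def a_def c_def)
  define q' where "q' = (if a ! g \<and> \<not> a ! i then q(i := q i + 1) else q)"
  have prev: "prev_site N j = i \<longleftrightarrow> j = g" if "j < N" for j
    using prev_site_inj[OF that len(5)] ig by simp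
  have q': "queue_lengths (ring i Q) q'"
    unfolding queue_lengths_def width_ring N_def[symmetric] a'_def[symmetric] c'_def[symmetric]
  proof (intro allI impI)
    fix j assume j: "j < N"
    consider "j = i" | "j = g" | "j \<noteq> i" "j \<noteq> g" by blast
    then show "q' j = q' (prev_site N j) + of_bool (a' ! j) - of_bool (c' ! j)"
    proof cases
      case 1
      have "\<not> c ! i" using i(2) by (simp add: c_def)
      then have "q i = q (prev_site N i) + of_bool (a ! i)" using rec[OF len(4)] by simp
      then show ?thesis
        using 1 a'[OF j] c'[OF j] ig \<open>\<not> c ! i\<close> by (cases "a ! i"; cases "a ! g") (simp_all add: q'_def)
    next
      case 2
      have "q g = q i + of_bool (a ! g) - of_bool (c ! g)" using rec[OF len(5)] ig(1) by simp
      then show ?thesis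
        using 2 a'[OF j] c'[OF j] ig by (cases "a ! i"; cases "a ! g") (simp_all add: q'_def)
    next
      case 3
      have "q' j = q j" "q' (prev_site N j) = q (prev_site N j)"
        using 3 prev[OF j] by (auto simp: q'_def)
      then show ?thesis using 3 a'[OF j] c'[OF j] rec[OF j] by simp
    qed
  qed
  have V: "j \<in> traversed Q \<longleftrightarrow> j < N \<and> 0 < q (prev_site N j) + of_bool (a ! j)" for j
    by (simp add: traversed_eq_busy[OF Q q] busy_sites_def N_def a_def)
  have V': "j \<in> traversed (ring i Q) \<longleftrightarrow> j < N \<and> 0 < q' (prev_site N j) + of_bool (a' ! j)" for j
    by (simp add: traversed_eq_busy[OF ring_in_queues[OF Q(1) i(1)] Q(2) q'] busy_sites_def
        N_def a'_def)
  have "j \<in> traversed (ring i Q) \<longleftrightarrow> j \<in> traversed Q \<or> j = i \<and> a ! g" for j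
  proof (cases "j < N")
    case True
    consider "j = i" | "j = g" | "j \<noteq> i" "j \<noteq> g" by blast
    then show ?thesis
    proof cases
      case 1
      then show ?thesis unfolding V V' a'[OF True] using True ig by (auto simp: q'_def)
    next
      case 2
      then show ?thesis unfolding V V' a'[OF True] using True ig by (auto simp: q'_def)
    next
      case 3
      have "q' (prev_site N j) = q (prev_site N j)" using 3 prev[OF True] by (auto simp: q'_def)
      then show ?thesis unfolding V V' a'[OF True] using 3 by simp
    qed
  qed (use len V V' in auto)
  then show ?thesis by (auto simp: a_def)
qed

text \<open>
  When the ringing site \<open>i\<close> is occupied in the bottom row, the service at \<open>i\<close> and an arrival at \<open>i\<close>
  move to the left neighbour \<open>h\<close> if there is room. Arrivals and services at the two sites together
  stay the same, and the queue lengths change only at \<open>h\<close>. The case left open, the membership of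
  \<open>i\<close> when \<open>h\<close> was vacant and nothing arrived at \<open>i\<close>, is the one in which a covered 3 may become
  non-covered.
\<close>

lemma traversed_ring_occupied:
  assumes Q: "Q \<in> queues m\<^sub>1 m\<^sub>2 m\<^sub>3" "m\<^sub>2 > 0" and N: "m\<^sub>1 + m\<^sub>2 + m\<^sub>3 \<ge> 3"
    and i: "i < width Q" "snd Q ! i"
  defines "h \<equiv> prev_site (width Q) i"
  shows "traversed (ring i Q) - {h, i} = traversed Q - {h, i}"
    and "h \<in> traversed (ring i Q) \<longleftrightarrow> fst Q ! i \<or> h \<in> traversed Q"
    and "fst Q ! i \<Longrightarrow> i \<in> traversed (ring i Q) \<longleftrightarrow> h \<in> traversed Q"
    and "\<not> fst Q ! i \<Longrightarrow> snd Q ! h \<Longrightarrow> i \<in> traversed (ring i Q) \<longleftrightarrow> i \<in> traversed Q"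
proof -
  define N a c where "N = width Q" and "a = fst Q" and "c = snd Q"
  define a' c' where "a' = fst (ring i Q)" and "c' = snd (ring i Q)"
  define f where "f = prev_site N h"
  have len: "length a = N" "length c = N" "N \<ge> 3" "i < N" "h < N"
    using queue_width[OF Q(1)] N i by (auto simp: N_def a_def c_def h_def)
  have h: "prev_site N i = h" by (simp add: h_def N_def)
  have ih: "h \<noteq> i" "f \<noteq> i" "f \<noteq> h"
    using len prev_site_neq[of i N] by (auto simp: h f_def)
  have a': "a' ! j = (if j = h then a ! h \<or> a ! i else if j = i then a ! h \<and> a ! i else a ! j)"
    if "j < N" for j
    using that len i(2)
    by (simp add: a'_def ring_eq top_site_def jump_left_nth Let_def h flip: a_def)
  have c': "c' ! j = (if j = h then True else if j = i then c ! h else c ! j)"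
    if "j < N" for j
    using that len i(2) by (auto simp: c'_def c_def ring_eq jump_left_nth Let_def h)
  obtain q where q: "queue_lengths Q q" using queue_lengths_exist[OF Q(1)] .
  have rec: "q j = q (prev_site N j) + of_bool (a ! j) - of_bool (c ! j)" if "j < N" for j
    using queue_lengthsD[OF q] that by (simp only: N_def a_def c_def)
  have qh: "q h = q f + of_bool (a ! h) - of_bool (c ! h)" using rec[OF len(5)] by (simp add: f_def)
  have qi: "q i = q h + of_bool (a ! i) - 1" using rec[OF len(4)] i(2) by (simp add: h c_def)
  \<comment> \<open>After the ring, \<open>h\<close> is occupied in the bottom row, and has an arrival if \<open>h\<close> or \<open>i\<close> had one.\<close>
  define q' where "q' = q(h := q f + of_bool (a ! h \<or> a ! i) - 1)"
  have prev: "prev_site N j = h \<longleftrightarrow> j = i" if "j < N" for j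
    using prev_site_inj[OF that len(4)] h by simp
  have q': "queue_lengths (ring i Q) q'"
    unfolding queue_lengths_def width_ring N_def[symmetric] a'_def[symmetric] c'_def[symmetric]
  proof (intro allI impI)
    fix j assume j: "j < N"
    consider "j = h" | "j = i" | "j \<noteq> h" "j \<noteq> i" by blast
    then show "q' j = q' (prev_site N j) + of_bool (a' ! j) - of_bool (c' ! j)"
    proof cases
      case 1
      then show ?thesis using a'[OF j] c'[OF j] ih by (simp add: q'_def flip: f_def)
    next
      case 2
      then show ?thesis using a'[OF j] c'[OF j] ih qh qi by (auto simp: q'_def h)
    next
      case 3
      have "q' j = q j" "q' (prev_site N j) = q (prev_site N j)"
        using 3 prev[OF j] by (auto simp: q'_def)
      then show ?thesis using 3 a'[OF j] c'[OF j] rec[OF j] by simp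
    qed
  qed
  have V: "j \<in> traversed Q \<longleftrightarrow> j < N \<and> 0 < q (prev_site N j) + of_bool (a ! j)" for j
    by (simp add: traversed_eq_busy[OF Q q] busy_sites_def N_def a_def)
  have V': "j \<in> traversed (ring i Q) \<longleftrightarrow> j < N \<and> 0 < q' (prev_site N j) + of_bool (a' ! j)" for j
    by (simp add: traversed_eq_busy[OF ring_in_queues[OF Q(1) i(1)] Q(2) q'] busy_sites_def
        N_def a'_def)
  show "traversed (ring i Q) - {h, i} = traversed Q - {h, i}"
    using V V' a' prev by (auto simp: q'_def)
  show "h \<in> traversed (ring i Q) \<longleftrightarrow> fst Q ! i \<or> h \<in> traversed Q"
    using ih len by (auto simp: V V' a' q'_def simp flip: f_def a_def)
  show "fst Q ! i \<Longrightarrow> i \<in> traversed (ring i Q) \<longleftrightarrow> h \<in> traversed Q"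
    using ih len by (auto simp: V V' a' q'_def h simp flip: f_def a_def)
  show "\<not> fst Q ! i \<Longrightarrow> snd Q ! h \<Longrightarrow> i \<in> traversed (ring i Q) \<longleftrightarrow> i \<in> traversed Q"
    using ih len qh by (auto simp: V V' a' q'_def h simp flip: f_def a_def c_def)
qed


section \<open>Stationarity\<close>

text \<open>
  This is why the weights are stationary. In the vacant case \<open>e = i\<close> whenever there is an arrival
  at the next site \<open>g\<close>, and otherwise \<open>e = g\<close>, which is traversed iff the vacant site \<open>i\<close> is. In
  the occupied case with an arrival at \<open>i\<close>, the exit site is \<open>h\<close> and the ring gives \<open>i\<close> the status
  that \<open>h\<close> had; without an arrival, \<open>e = i\<close> and all other sites keep their status.
\<close>

lemma card_traversed_ring:
  assumes Q: "Q \<in> queues m\<^sub>1 m\<^sub>2 m\<^sub>3" "m\<^sub>2 > 0" and N: "m\<^sub>1 + m\<^sub>2 + m\<^sub>3 \<ge> 3" and i: "i < width Q"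
  shows "card (traversed (ring i Q) - {ring_exit i Q}) = card (traversed Q - {i})"
proof -
  have fin: "finite (traversed Q)" using traversed_less[OF Q(1)] finite_subset by blast
  have a: "length (fst Q) = width Q" using queue_width[OF Q(1)] by simp
  show ?thesis
  proof (cases "snd Q ! i")
    case False
    define g where "g = next_site (width Q) i"
    have g: "g < width Q" "prev_site (width Q) g = i" using i by (auto simp: g_def)
    note V' = traversed_ring_vacant[OF Q N i False, folded g_def]
    have e: "ring_exit i Q = (if fst Q ! g then i else g)"
      using False g a by (simp add: ring_exit_def exit_site_def top_site_def flip: g_def)
    show ?thesis
    proof (cases "fst Q ! g")
      case False
      then have "g \<in> traversed Q \<longleftrightarrow> i \<in> traversed Q"
        using traversed_prev[OF Q g(1)] g(2) \<open>\<not> snd Q ! i\<close> by auto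
      then show ?thesis using V' e False fin by (auto simp: card_Diff_singleton_if)
    qed (use V' e in simp)
  next
    case True
    define h where "h = prev_site (width Q) i"
    note V' = traversed_ring_occupied[OF Q N i True, folded h_def]
    have hi: "h \<noteq> i" using prev_site_neq[OF i] N queue_width[OF Q(1)] by (simp add: h_def)
    have e: "ring_exit i Q = (if fst Q ! i then h else i)"
      using True a by (simp add: ring_exit_def exit_site_def top_site_def h_def)
    show ?thesis
    proof (cases "fst Q ! i")
      case False
      then have "traversed (ring i Q) - {i} = traversed Q - {i}" using V'(1,2) by auto
      then show ?thesis using e False by simp
    next
      case True
      define R where "R = traversed Q - {h, i}"
      have "traversed (ring i Q) - {h} = (if h \<in> traversed Q then insert i R else R)"
        "traversed Q - {i} = (if h \<in> traversed Q then insert h R else R)"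
        using V'(1) V'(3)[OF True] hi by (auto simp: R_def)
      moreover have "finite R" "h \<notin> R" "i \<notin> R" using fin by (auto simp: R_def)
      ultimately show ?thesis using e True by simp
    qed
  qed
qed

definition queue_weight :: "nat \<Rightarrow> (nat \<Rightarrow> real) \<Rightarrow> queue \<Rightarrow> real" where
  "queue_weight m x Q = (let k = card (covered_threes Q) in x 1 ^ (m - k) * x 2 ^ k)"

text \<open>
  If \<open>x 1 \<noteq> 0\<close> then weight times rate is \<open>(x 2 / x 1) ^ card (V - {i})\<close> up to a factor that does
  not depend on the state and the site. The comparison of exponents below avoids the division.
\<close>

lemma ring_rate_weight:
  assumes Q: "Q \<in> queues m\<^sub>1 m\<^sub>2 m\<^sub>3" "m\<^sub>2 > 0" and N: "m\<^sub>1 + m\<^sub>2 + m\<^sub>3 \<ge> 3" and i: "i < width Q"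
  shows "ring_rate x (ring i Q) (ring_exit i Q) * queue_weight m\<^sub>3 x (ring i Q)
    = ring_rate x Q i * queue_weight m\<^sub>3 x Q"
proof -
  define e V V' k k' where "e = ring_exit i Q" and "V = traversed Q" and "V' = traversed (ring i Q)"
    and "k = card (covered_threes Q)" and "k' = card (covered_threes (ring i Q))"
  note Q' = ring_in_queues[OF Q(1) i]
  have fin: "finite V" "finite V'"
    using traversed_less[OF Q(1)] traversed_less[OF Q'] finite_subset by (auto simp: V_def V'_def)
  have k: "card V = m\<^sub>1 + k" "k \<le> m\<^sub>3" "card V' = m\<^sub>1 + k'" "k' \<le> m\<^sub>3"
    using card_traversed(1,2)[OF Q(1)] card_traversed(1,2)[OF Q']
    by (auto simp: V_def V'_def k_def k'_def)
  have "card (V' - {e}) = card (V - {i})"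
    using card_traversed_ring[OF Q N i] by (simp add: V_def V'_def e_def)
  then have "k' + of_bool (i \<in> V) = k + of_bool (e \<in> V')"
    using fin k card_gt_0_iff[of V] card_gt_0_iff[of V']
    by (auto simp: card_Diff_singleton_if split: if_splits)
  moreover have "ring_rate x Q i = (if i \<in> V then x 1 else x 2)"
    "ring_rate x (ring i Q) e = (if e \<in> V' then x 1 else x 2)"
    using ring_rate_eq[OF Q(1) i] ring_rate_eq[OF Q'] ring_exit_less[OF Q(1) i]
    by (auto simp: V_def V'_def e_def)
  moreover have "m\<^sub>3 - k = Suc (m\<^sub>3 - k')" if "k' = Suc k" using that k by simp
  moreover have "m\<^sub>3 - k' = Suc (m\<^sub>3 - k)" if "k = Suc k'" using that k by simp
  ultimately show ?thesis
    unfolding queue_weight_def Let_def e_def[symmetric] k_def[symmetric] k'_def[symmetric]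
    by (auto split: if_splits)
qed

lemma finite_queues: "finite (queues m\<^sub>1 m\<^sub>2 m\<^sub>3)"
proof (rule finite_subset)
  define L where "L = {xs :: bool list. set xs \<subseteq> UNIV \<and> length xs = m\<^sub>1 + m\<^sub>2 + m\<^sub>3}"
  show "queues m\<^sub>1 m\<^sub>2 m\<^sub>3 \<subseteq> L \<times> L" by (auto simp: queues_def L_def)
  show "finite (L \<times> L)" unfolding L_def by (intro finite_cartesian_product finite_lists_length_eq) auto
qed

text \<open>
  Rings that do not change the state add the same amount to both sides of the balance equation, so
  all sums may run over all states; then inflow becomes outflow by reindexing along the
  permutation \<open>F\<close>.
\<close>

lemma stationary_queue_weight:
  assumes m: "m\<^sub>2 > 0" and N: "m\<^sub>1 + m\<^sub>2 + m\<^sub>3 \<ge> 3"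
  shows "stationary_weight (queues m\<^sub>1 m\<^sub>2 m\<^sub>3) (multiline_rate x) (queue_weight m\<^sub>3 x)"
  unfolding stationary_weight_def
proof
  define S n w where "S = queues m\<^sub>1 m\<^sub>2 m\<^sub>3" and "n = m\<^sub>1 + m\<^sub>2 + m\<^sub>3" and "w = queue_weight m\<^sub>3 x"
  have fin: "finite S" and wd: "\<And>s. s \<in> S \<Longrightarrow> width s = n"
    using finite_queues queue_width by (auto simp: S_def n_def)
  define F where "F = (\<lambda>(s, i). (ring i s, ring_exit i s))"
  have F: "bij_betw F (S \<times> {..<n}) (S \<times> {..<n})"
  proof -
    have "inj_on F (S \<times> {..<n})"
      using ring_inj[OF _ _ _ _ N] by (auto simp: inj_on_def F_def S_def n_def)
    moreover have "F ` (S \<times> {..<n}) \<subseteq> S \<times> {..<n}"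
      using ring_in_queues ring_exit_less wd by (fastforce simp: F_def S_def)
    ultimately show ?thesis
      using endo_inj_surj[of "S \<times> {..<n}" F] fin by (simp add: bij_betw_def)
  qed
  fix t assume "t \<in> queues m\<^sub>1 m\<^sub>2 m\<^sub>3"
  then have t: "t \<in> S" by (simp add: S_def)
  define G where "G = (\<lambda>(s, i). if s = t then ring_rate x s i * w s else 0)"
  have "(\<Sum>s\<in>S. multiline_rate x s t * w s)
      = (\<Sum>s\<in>S. \<Sum>i<n. if ring i s = t then ring_rate x s i * w s else 0)"
    by (intro sum.cong refl) (auto simp: multiline_rate_def wd sum_distrib_right intro!: sum.cong)
  also have "\<dots> = (\<Sum>p\<in>S \<times> {..<n}. G (F p))"
    unfolding sum.cartesian_product
    by (intro sum.cong refl)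
      (use ring_rate_weight[OF _ m N] wd in \<open>auto simp: G_def F_def S_def w_def\<close>)
  also have "\<dots> = (\<Sum>p\<in>S \<times> {..<n}. G p)" by (rule sum.reindex_bij_betw[OF F])
  also have "\<dots> = (\<Sum>s\<in>S. \<Sum>i<n. if s = t then ring_rate x s i * w s else 0)"
    by (simp add: G_def sum.cartesian_product)
  also have "\<dots> = (\<Sum>s\<in>S. if s = t then \<Sum>i<n. ring_rate x t i * w t else 0)"
    by (intro sum.cong refl) auto
  also have "\<dots> = (\<Sum>i<n. ring_rate x t i * w t)" using fin t by simp
  also have "\<dots> = (\<Sum>i<n. \<Sum>s\<in>S. if ring i t = s then ring_rate x t i * w t else 0)"
    using fin t ring_in_queues wd by (intro sum.cong refl) (auto simp: S_def)
  also have "\<dots> = (\<Sum>s\<in>S. \<Sum>i<n. if ring i t = s then ring_rate x t i * w t else 0)"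
    by (rule sum.swap)
  also have "\<dots> = (\<Sum>s\<in>S. multiline_rate x t s * w t)"
    by (intro sum.cong refl) (auto simp: multiline_rate_def wd[OF t] sum_distrib_right intro!: sum.cong)
  finally show "(\<Sum>s\<in>queues m\<^sub>1 m\<^sub>2 m\<^sub>3 - {t}. multiline_rate x s t * queue_weight m\<^sub>3 x s)
      = (\<Sum>s\<in>queues m\<^sub>1 m\<^sub>2 m\<^sub>3 - {t}. multiline_rate x t s * queue_weight m\<^sub>3 x t)"
    unfolding S_def[symmetric] w_def[symmetric] using fin t by (simp add: sum_diff1)
qed


section \<open>Lumping\<close>

text \<open>
  If the bottom row is vacant at \<open>i\<close>, only the covering of a 3 can change. If a particle jumps into
  a vacancy at \<open>h\<close>, its class is preserved because it depends on whether there is a customer at \<open>h\<close>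
  or \<open>i\<close>. If both sites are occupied, an arrival at \<open>i\<close> makes \<open>h\<close> first class and hands the old
  class of \<open>h\<close> to \<open>i\<close>; without an arrival both classes stay, and \<open>h\<close> cannot be the worse one.
\<close>

lemma projection_ring:
  assumes Q: "Q \<in> queues m\<^sub>1 m\<^sub>2 m\<^sub>3" "m\<^sub>2 > 0" and N: "m\<^sub>1 + m\<^sub>2 + m\<^sub>3 \<ge> 3" and i: "i < width Q"
  defines "h \<equiv> prev_site (width Q) i" and "\<pi> \<equiv> bully_projection Q"
  shows "bully_projection (ring i Q) = (if \<pi> ! h > \<pi> ! i then interchange h i \<pi> else \<pi>)"
proof (rule nth_equalityI)
  define V V' where "V = traversed Q" and "V' = traversed (ring i Q)"
  fix j assume "j < length (bully_projection (ring i Q))"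
  then have j: "j < width Q" by simp
  note Q' = ring_in_queues[OF Q(1) i]
  have h: "h < width Q" "h \<noteq> i"
    using prev_site_neq[OF i] N queue_width[OF Q(1)] i by (auto simp: h_def)
  have cl: "\<pi> ! k = (if \<not> snd Q ! k then 3 else if k \<in> V then 1 else 2)" if "k < width Q" for k
    using projection_nth[OF Q(1) that] by (simp add: \<pi>_def V_def)
  have cl': "bully_projection (ring i Q) ! k =
      (if \<not> snd (ring i Q) ! k then 3 else if k \<in> V' then 1 else 2)" if "k < width Q" for k
    using projection_nth[OF Q'] that by (simp add: V'_def)
  have c': "snd (ring i Q) ! k = (if k = h then snd Q ! h \<or> snd Q ! i
      else if k = i then snd Q ! h \<and> snd Q ! i else snd Q ! k)" if "k < width Q" for k
    using that i by (simp add: ring_eq jump_left_nth width_def h_def Let_def)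
  have int: "interchange h i \<pi> ! j = (if j = i then \<pi> ! h else if j = h then \<pi> ! i else \<pi> ! j)"
    using h i j by (simp add: interchange_nth \<pi>_def)
  show "bully_projection (ring i Q) ! j = (if \<pi> ! h > \<pi> ! i then interchange h i \<pi> else \<pi>) ! j"
  proof (cases "snd Q ! i")
    case False
    have "snd Q ! j \<Longrightarrow> j \<in> V' \<longleftrightarrow> j \<in> V"
      using traversed_ring_vacant[OF Q N i False] False by (auto simp: V_def V'_def)
    then show ?thesis using cl[OF h(1)] cl[OF i] cl[OF j] cl'[OF j] c'[OF j] False by auto
  next
    case True
    note V' = traversed_ring_occupied[OF Q N i True, folded h_def V_def V'_def]
    note V = traversed_prev[OF Q i, folded h_def V_def]
    consider "j = h" | "j = i" | "j \<noteq> h" "j \<noteq> i" by blast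
    then show ?thesis
    proof cases
      case 1
      then show ?thesis using int cl[OF h(1)] cl[OF i] cl'[OF j] c'[OF j] True V V'(2) h by auto
    next
      case 2
      then show ?thesis using int cl[OF h(1)] cl[OF i] cl'[OF j] c'[OF j] True V V'(2-4) h by auto
    next
      case 3
      then have "j \<in> V' \<longleftrightarrow> j \<in> V" using V'(1) by auto
      then show ?thesis using 3 int cl[OF j] cl'[OF j] c'[OF j] by auto
    qed
  qed
qed (simp add: \<pi>_def interchange_def)

text \<open>
  A ring at \<open>i\<close> corresponds to the interchange of the letters at \<open>i - 1\<close> and \<open>i\<close>, whereas the rates
  of the exclusion process are indexed by the left one of the two sites; hence the shift of the
  summation index. When the letters are out of order, the one at \<open>i\<close> is 1 or 2, and its rate is
  the ringing rate.
\<close>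

lemma lumps_multiline:
  assumes m: "m\<^sub>2 > 0" and N: "m\<^sub>1 + m\<^sub>2 + m\<^sub>3 \<ge> 3"
  shows "lumps_via (queues m\<^sub>1 m\<^sub>2 m\<^sub>3) (multiline_rate x) bully_projection
    (words m\<^sub>1 m\<^sub>2 m\<^sub>3) (exclusion_rate x)"
  unfolding lumps_via_def
proof (intro conjI ballI impI)
  show "bully_projection ` queues m\<^sub>1 m\<^sub>2 m\<^sub>3 \<subseteq> words m\<^sub>1 m\<^sub>2 m\<^sub>3"
    using projection_in_words by blast
  fix Q \<rho> assume Q: "Q \<in> queues m\<^sub>1 m\<^sub>2 m\<^sub>3" and \<rho>: "\<rho> \<noteq> bully_projection Q"
  define \<pi> n where "\<pi> = bully_projection Q" and "n = width Q"
  define S where "S = {Q' \<in> queues m\<^sub>1 m\<^sub>2 m\<^sub>3. bully_projection Q' = \<rho>}"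
  define f where "f = (\<lambda>h i. if \<pi> ! h > \<pi> ! i \<and> \<rho> = interchange h i \<pi> then x (\<pi> ! i) else 0)"
  have fin: "finite S" using finite_queues by (simp add: S_def)
  have "(\<Sum>Q'\<in>S. multiline_rate x Q Q') = (\<Sum>i<n. \<Sum>Q'\<in>S. if ring i Q = Q' then ring_rate x Q i else 0)"
    unfolding multiline_rate_def n_def by (rule sum.swap)
  also have "\<dots> = (\<Sum>i<n. f (prev_site n i) i)"
  proof (intro sum.cong refl)
    fix i assume "i \<in> {..<n}"
    then have i: "i < width Q" by (simp add: n_def)
    define h where "h = prev_site n i"
    have "h < width Q" using i by (simp add: h_def n_def)
    have "(\<Sum>Q'\<in>S. if ring i Q = Q' then ring_rate x Q i else 0)
        = (if bully_projection (ring i Q) = \<rho> then ring_rate x Q i else 0)"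
      using fin ring_in_queues[OF Q i] by (simp add: S_def)
    also have "\<dots> = f h i"
    proof -
      have "ring_rate x Q i = x (\<pi> ! i)" if "\<pi> ! h > \<pi> ! i"
        using that projection_nth[OF Q i] projection_nth[OF Q \<open>h < width Q\<close>] ring_rate_eq[OF Q i]
        by (auto simp: \<pi>_def split: if_splits)
      then show ?thesis
        using projection_ring[OF Q m N i] \<rho> by (auto simp: f_def h_def \<pi>_def n_def)
    qed
    finally show "(\<Sum>Q'\<in>S. if ring i Q = Q' then ring_rate x Q i else 0) = f (prev_site n i) i"
      by (simp add: h_def)
  qed
  also have "\<dots> = (\<Sum>i<n. f (prev_site n (next_site n i)) (next_site n i))"
    by (rule sum.reindex_bij_betw[OF bij_betw_next_site, symmetric])
  also have "\<dots> = (\<Sum>i<n. f i (next_site n i))" by (intro sum.cong) auto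
  also have "\<dots> = exclusion_rate x \<pi> \<rho>"
  proof -
    have "length \<pi> = n" by (simp add: \<pi>_def n_def)
    then show ?thesis by (simp add: exclusion_rate_def Let_def f_def)
  qed
  finally show "(\<Sum>Q'\<in>{Q' \<in> queues m\<^sub>1 m\<^sub>2 m\<^sub>3. bully_projection Q' = \<rho>}. multiline_rate x Q Q')
      = exclusion_rate x (bully_projection Q) \<rho>"
    by (simp add: S_def \<pi>_def)
qed

theorem theorem3p3:
  fixes m\<^sub>1 m\<^sub>2 m\<^sub>3 :: nat and x :: "nat \<Rightarrow> real"
  assumes "m\<^sub>1 > 0" and "m\<^sub>2 > 0" and "m\<^sub>3 > 0"
    and "x 1 > 0" and "x 2 > 0"
  shows "stationary_weight (queues m\<^sub>1 m\<^sub>2 m\<^sub>3) (multiline_rate x)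
           (\<lambda>Q. let k = card (covered_threes Q) in x 1 ^ (m\<^sub>3 - k) * x 2 ^ k)
       \<and> lumps_via (queues m\<^sub>1 m\<^sub>2 m\<^sub>3) (multiline_rate x) bully_projection
           (words m\<^sub>1 m\<^sub>2 m\<^sub>3) (exclusion_rate x)"
  using stationary_queue_weight[of m\<^sub>2 m\<^sub>1 m\<^sub>3 x] lumps_multiline[of m\<^sub>2 m\<^sub>1 m\<^sub>3 x] assms
  by (simp add: queue_weight_def[abs_def])

end
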